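(* Let $m\ge1$ and let $a_1,\ldots,a_m$ be positive integers with $\min\{a_1,\ldots,a_m\}=1$. Let $f:\mathbb N\to\mathbb Q$ and write $\Delta f(k)=f(k+1)-f(k)$. Let $n$ be a positive integer. (i) If $\binom{2k-1}kf(k)\in\mathbb Z$ for all $k\in\mathbb N$, then $$\sum_{k=0}^{n-1}\Delta f(k)\prod_{i=1}^m\binom{a_in-1}{k}\binom{-a_in-1}k\in\mathbb Z.$$ (ii) If $\binom{2k-1}kf(k)\in k\mathbb Z$ for all $k\in\mathbb N$, then $$\frac1n\sum_{k=0}^{n-1}\Delta f(k)\prod_{i=1}^m\binom{a_in-1}{k}\binom{-a_in-1}k\in\mathbb Z.$$
   Context: For an integer $x$ and $k\in\mathbb N$, $\binom xk=x(x-1)\cdots(x-k+1)/k!$; in particular $\binom{-1}0=1$. *)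

theory Defs
  imports Complex_Main
begin

definition fwd_diff :: "(nat \<Rightarrow> rat) \<Rightarrow> nat \<Rightarrow> rat" where
  "fwd_diff f k = f (k + 1) - f k"

text \<open>
  The generalised binomial is taken over the rationals, where
  \<open>x gchoose k = x (x - 1) \<dots> (x - k + 1) / k!\<close> with exact division; the first arguments used
  here are always (images of) integers, and subtraction is not truncated.
\<close>
definition int_binom :: "int \<Rightarrow> nat \<Rightarrow> rat" where
  "int_binom x k = (of_int x :: rat) gchoose k"

text \<open>
  The subset \<open>k\<int>\<close> of the rationals; in particular it is \<open>{0}\<close> for \<open>k = 0\<close>.
\<close>
definition int_multiples :: "nat \<Rightarrow> rat set" where
  "int_multiples k = {of_nat k * z | z. z \<in> \<int>}"

end

theory Submission
  imports Defs "HOL.Binomial_Plus"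
begin

text \<open>
  Put \<open>p(x, k) = binom(x - 1, k) binom(-x - 1, k)\<close>, so that
  \<open>p(x, k) = (1 - x\<^sup>2 / 1\<^sup>2) \<dots> (1 - x\<^sup>2 / k\<^sup>2)\<close>, and let \<open>P(k)\<close> be the product of
  the \<open>p(a\<^sub>i n, k)\<close>. As some \<open>a\<^sub>i\<close> is 1, \<open>P(n) = 0\<close>, and Abel summation reduces the claims to
  the integrality, or divisibility by \<open>n\<close>, of \<open>f(k) (P(k) - P(k - 1))\<close>; replacing the factors of
  \<open>P\<close> one at a time, it suffices to treat \<open>f(k) (p(x, k) - p(x, k - 1))\<close> for \<open>x = a\<^sub>i n\<close>. Up to
  sign, \<open>p(x, k) - p(x, k - 1)\<close> is \<open>(x / k) binom(x + k - 1, 2 k - 1) binom(2 k - 1, k)\<close>. The last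
  factor clears the denominator of \<open>f(k)\<close>. In (ii) it also yields a factor \<open>k\<close> cancelling the
  denominator, and \<open>x\<close> is a multiple of \<open>n\<close>; in (i) one uses
  \<open>(x / k) binom(x + k - 1, 2 k - 1) = binom(x + k, 2 k) + binom(x + k - 1, 2 k)\<close>.
\<close>

section \<open>Multiples of \<open>d\<close> among the rationals; telescoping of products and
  sums\<close>

lemma int_binom_in_Ints: "int_binom x k \<in> \<int>"
  by (simp add: int_binom_def flip: of_int_gbinomial)

lemma int_multiplesI: "z \<in> \<int> \<Longrightarrow> of_nat d * z \<in> int_multiples d"
  by (auto simp: int_multiples_def)

lemma int_multiplesE:
  assumes "x \<in> int_multiples d" obtains z where "z \<in> \<int>" "x = of_nat d * z"
  using assms by (auto simp: int_multiples_def)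

text \<open>Lets (i) and (ii) share one argument, with \<open>d = 1\<close> and \<open>d = n\<close>
  respectively.\<close>

lemma int_multiples_1: "int_multiples 1 = \<int>"
  by (auto simp: int_multiples_def)

lemma int_multiples_0: "0 \<in> int_multiples d"
  using int_multiplesI[of 0 d] by simp

lemma int_multiples_add: "x \<in> int_multiples d \<Longrightarrow> y \<in> int_multiples d \<Longrightarrow> x + y \<in> int_multiples d"
  by (auto simp: int_multiples_def simp flip: distrib_left)

lemma int_multiples_minus: "x \<in> int_multiples d \<Longrightarrow> - x \<in> int_multiples d"
  using int_multiplesI[of "- z" d for z] by (fastforce elim!: int_multiplesE)

lemma int_multiples_mult_Ints: "x \<in> int_multiples d \<Longrightarrow> y \<in> \<int> \<Longrightarrow> x * y \<in> int_multiples d"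
  by (auto simp: int_multiples_def mult.assoc)

lemma int_multiples_sum:
  "(\<And>i. i \<in> S \<Longrightarrow> g i \<in> int_multiples d) \<Longrightarrow> sum g S \<in> int_multiples d"
  by (induction S rule: infinite_finite_induct) (auto intro: int_multiples_add int_multiples_0)

text \<open>Exchanging one factor at a time gives differences \<open>u i - v i\<close> multiplied by
  integer factors. Only the products \<open>c * (u i - v i)\<close> are controlled; \<open>c\<close>
  itself may be a fraction.\<close>

lemma prod_diff_in_int_multiples:
  assumes "finite S"
    and "\<And>i. i \<in> S \<Longrightarrow> u i \<in> \<int>" and "\<And>i. i \<in> S \<Longrightarrow> v i \<in> \<int>"
    and "\<And>i. i \<in> S \<Longrightarrow> c * (u i - v i) \<in> int_multiples d"
  shows "c * (prod u S - prod v S) \<in> int_multiples d"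
  using assms
proof (induction S rule: finite_induct)
  case empty
  then show ?case by (simp add: int_multiples_0)
next
  case (insert i S)
  have "c * (prod u (insert i S) - prod v (insert i S))
      = c * (u i - v i) * prod u S + c * (prod u S - prod v S) * v i"
    using insert.hyps by (simp add: algebra_simps)
  also have "\<dots> \<in> int_multiples d"
    by (intro int_multiples_add int_multiples_mult_Ints insert Ints_prod) (use insert in auto)
  finally show ?case .
qed

text \<open>Abel summation; \<open>P n = 0\<close> removes the upper boundary term.\<close>

lemma sum_fwd_diff_mult:
  assumes "P n = 0"
  shows "(\<Sum>k = 0..<n. fwd_diff f k * P k)
    = - f 0 * P 0 - (\<Sum>k = 0..<n. f (Suc k) * (P (Suc k) - P k))"
proof -
  have "(\<Sum>k = 0..<n. fwd_diff f k * P k + f (Suc k) * (P (Suc k) - P k))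
      = (\<Sum>k = 0..<n. f (Suc k) * P (Suc k) - f k * P k)"
    by (intro sum.cong) (auto simp: fwd_diff_def algebra_simps)
  also have "\<dots> = - f 0 * P 0"
    using assms sum_Suc_diff'[of 0 n "\<lambda>k. f k * P k"] by simp
  finally show ?thesis
    by (simp add: sum.distrib)
qed

section \<open>The function \<open>p(x, k)\<close> and its differences in \<open>k\<close>\<close>

definition sym_binom :: "rat \<Rightarrow> nat \<Rightarrow> rat" where
  "sym_binom x k = (x - 1 gchoose k) * (- x - 1 gchoose k)"

lemma gbinomial_Suc_mult:
  fixes a :: "'a::field_char_0"
  shows "of_nat (Suc k) * (a gchoose Suc k) = (a - of_nat k) * (a gchoose k)"
  using gbinomial_mult_1[of a k] by (simp add: algebra_simps)

lemma gbinomial_Suc_eq: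
  fixes a :: "'a::field_char_0"
  shows "a gchoose Suc k = (a - of_nat k) * (a gchoose k) / of_nat (Suc k)"
  using gbinomial_Suc_mult[of k a] by (simp add: field_simps del: of_nat_Suc)

text \<open>The two binomials gain the numerators \<open>x - (k + 1)\<close> and
  \<open>- x - (k + 1)\<close>, whose product is \<open>(k + 1)^2 - x^2\<close>.\<close>

lemma sym_binom_Suc: "sym_binom x (Suc k) = sym_binom x k * (1 - x\<^sup>2 / of_nat (Suc k) ^ 2)"
proof -
  have "of_nat (Suc k) \<noteq> (0 :: rat)" by (simp del: of_nat_Suc)
  then show ?thesis
    unfolding sym_binom_def gbinomial_Suc_eq
    by (simp add: divide_simps power2_eq_square del: of_nat_Suc) (simp add: algebra_simps)
qed

text \<open>The extra \<open>x\<close> fills the gap at 0: up to a constant, the left side is the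
  product of the consecutive factors \<open>x - k\<close>, ..., \<open>x + k\<close>, hence a single
  binomial. The constant is \<open>(-1)^k (2k+1)! / (k!)^2\<close>.\<close>

lemma sym_binom_mult:
  "x * sym_binom x k = (- 1) ^ k * of_nat (Suc k) * (x + of_nat k gchoose (2 * k + 1))
     * (of_nat (2 * k + 1) gchoose Suc k)"
proof (induction k)
  case 0
  then show ?case by (simp add: sym_binom_def)
next
  case (Suc k)
  define q :: rat where "q = of_nat k"
  define A where "A = (x + q gchoose (2 * k + 1))"
  define B where "B = (2 * q + 1 gchoose Suc k)"
  have q: "q \<ge> 0" by (simp add: q_def)
  \<comment> \<open>The run of consecutive factors grows by one at each end.\<close>
  have 1: "(x + of_nat (Suc k) gchoose (2 * Suc k + 1))
      = (x + q + 1) * (x - q - 1) / ((2 * q + 3) * (2 * q + 2)) * A"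
  proof -
    have "x + of_nat (Suc k) gchoose (2 * Suc k + 1) = ((x + q) + 1 gchoose Suc (Suc (2 * k + 1)))"
      by (simp add: q_def algebra_simps)
    also have "\<dots> = (x + q + 1) / (2 * q + 3) * ((x + q) gchoose Suc (2 * k + 1))"
      by (subst gbinomial_factors) (simp add: q_def algebra_simps)
    also have "(x + q) gchoose Suc (2 * k + 1) = (x - q - 1) * A / (2 * q + 2)"
      by (subst gbinomial_Suc_eq) (simp add: q_def A_def algebra_simps)
    finally show ?thesis by simp
  qed
  have 2: "(of_nat (2 * Suc k + 1) gchoose Suc (Suc k))
      = (2 * q + 3) * (2 * q + 2) / ((q + 2) * (q + 1)) * B"
  proof -
    have "(of_nat (2 * Suc k + 1) gchoose Suc (Suc k)) = ((2 * q + 2) + 1 gchoose Suc (Suc k))"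
      by (simp add: q_def algebra_simps)
    also have "\<dots> = (2 * q + 3) / (q + 2) * (((2 * q + 1) + 1) gchoose Suc k)"
      by (subst gbinomial_factors) (simp add: q_def algebra_simps)
    also have "(((2 * q + 1) + 1) gchoose Suc k) = (2 * q + 2) / (q + 1) * ((2 * q + 1) gchoose k)"
      by (subst gbinomial_factors) (simp add: q_def algebra_simps)
    \<comment> \<open>Symmetry of the middle binomials: the step from \<open>k\<close> to
      \<open>Suc k\<close> multiplies by \<open>(2 * q + 1 - k) / (k + 1) = 1\<close>.\<close>
    also have "(2 * q + 1) gchoose k = B"
      using gbinomial_Suc_eq[of "2 * q + 1" k] q by (simp add: B_def q_def add.commute)
    finally show ?thesis by simp
  qed
  have IH: "x * sym_binom x k = (- 1) ^ k * (q + 1) * A * B"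
    using Suc.IH by (simp add: q_def A_def B_def algebra_simps)
  have "x * sym_binom x (Suc k) = (x * sym_binom x k) * (1 - x\<^sup>2 / (q + 1) ^ 2)"
    by (simp add: sym_binom_Suc q_def add.commute)
  also have "\<dots> = (- 1) ^ k * (q + 1) * A * B * (1 - x\<^sup>2 / (q + 1) ^ 2)"
    by (simp add: IH)
  also have "\<dots> = (- 1) ^ Suc k * (q + 2) * ((x + q + 1) * (x - q - 1) / ((2 * q + 3) * (2 * q + 2)) * A)
     * ((2 * q + 3) * (2 * q + 2) / ((q + 2) * (q + 1)) * B)"
  proof -
    have nz: "q + 1 \<noteq> 0" "q + 2 \<noteq> 0" "2 * q + 3 \<noteq> 0" "2 * q + 2 \<noteq> 0" using q by linarith+
    have "(q + 1) * (1 - x\<^sup>2 / (q + 1) ^ 2) = - ((x + q + 1) * (x - q - 1)) / (q + 1)"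
      using nz by (simp add: divide_simps power2_eq_square) (simp add: algebra_simps)
    then have "(q + 1) * A * B * (1 - x\<^sup>2 / (q + 1) ^ 2) = - ((x + q + 1) * (x - q - 1) / (q + 1) * A * B)"
      by (simp add: mult_ac)
    moreover have "(q + 2) * ((x + q + 1) * (x - q - 1) / ((2 * q + 3) * (2 * q + 2)) * A)
     * ((2 * q + 3) * (2 * q + 2) / ((q + 2) * (q + 1)) * B)
       = (x + q + 1) * (x - q - 1) / (q + 1) * A * B"
      using nz by simp
    ultimately show ?thesis
      by (simp only: power_Suc mult.assoc mult_minus_left mult_minus_right mult_1)
  qed
  finally show ?case
    unfolding 1 2 by (simp add: q_def add.commute)
qed

lemma sym_binom_diff:
  "sym_binom x (Suc k) - sym_binom x k = - ((- 1) ^ k * x / of_nat (Suc k)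
     * (x + of_nat k gchoose (2 * k + 1)) * (of_nat (2 * k + 1) gchoose Suc k))"
proof -
  have nz: "of_nat (Suc k) \<noteq> (0 :: rat)" by (simp del: of_nat_Suc)
  \<comment> \<open>One \<open>x\<close> of \<open>x^2\<close> is grouped with
    \<open>sym_binom x k\<close> so that \<open>sym_binom_mult\<close> applies; its factor
    \<open>Suc k\<close> then cancels one of the two in the denominator.\<close>
  have "sym_binom x (Suc k) - sym_binom x k = - (x * (x * sym_binom x k)) / of_nat (Suc k) ^ 2"
    unfolding sym_binom_Suc by (simp add: algebra_simps power2_eq_square del: of_nat_Suc)
  then show ?thesis
    unfolding sym_binom_mult using nz by (simp add: field_simps power2_eq_square del: of_nat_Suc)
qed

text \<open>Both terms on the right are multiples of the binomial on the left, by
  \<open>(x + k + 1) / (2 (k + 1))\<close> and \<open>(x - k - 1) / (2 (k + 1))\<close>. For integer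
  \<open>x\<close> this shows the left side to be an integer despite its denominator.\<close>

lemma gbinomial_even_sum:
  fixes x :: "'a::field_char_0"
  shows "x / of_nat (Suc k) * (x + of_nat k gchoose (2 * k + 1))
    = (x + of_nat (Suc k) gchoose (2 * Suc k)) + (x + of_nat k gchoose (2 * Suc k))"
proof -
  define q :: 'a where "q = of_nat k"
  define A where "A = (x + q gchoose (2 * k + 1))"
  have "x + of_nat (Suc k) gchoose (2 * Suc k) = ((x + q) + 1 gchoose Suc (2 * k + 1))"
    by (simp add: q_def algebra_simps)
  also have "\<dots> = (x + q + 1) / (2 * (q + 1)) * A"
    by (subst gbinomial_factors) (simp add: q_def A_def algebra_simps)
  finally have 1: "x + of_nat (Suc k) gchoose (2 * Suc k) = (x + q + 1) / (2 * (q + 1)) * A" .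
  have "x + of_nat k gchoose (2 * Suc k) = (x + q gchoose Suc (2 * k + 1))"
    by (simp add: q_def algebra_simps)
  also have "\<dots> = (x - q - 1) * A / (2 * (q + 1))"
    by (subst gbinomial_Suc_eq) (simp add: q_def A_def algebra_simps)
  finally have 2: "x + of_nat k gchoose (2 * Suc k) = (x - q - 1) * A / (2 * (q + 1))" .
  have 3: "x / of_nat (Suc k) * (x + of_nat k gchoose (2 * k + 1)) = x / (q + 1) * A"
    by (simp add: q_def A_def add.commute)
  show ?thesis
  proof -
    have "(x + q + 1) / (2 * (q + 1)) * A + (x - q - 1) * A / (2 * (q + 1))
        = (2 * (x * A)) / (2 * (q + 1))"
      by (simp only: times_divide_eq_left add_divide_distrib[symmetric]) (simp add: algebra_simps)
    also have "\<dots> = x / (q + 1) * A" by (simp only: mult_divide_mult_cancel_left_if) simp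
    finally show ?thesis unfolding 1 2 3 by simp
  qed
qed

section \<open>Integrality and divisibility for a single factor\<close>

lemma sym_binom_of_int:
  "sym_binom (of_int x) k = int_binom (x - 1) k * int_binom (- x - 1) k"
  by (simp add: sym_binom_def int_binom_def)

lemma mult_sym_binom_diff_in_Ints:
  assumes "int_binom (2 * int (Suc k) - 1) (Suc k) * c \<in> \<int>"
  shows "c * (sym_binom (of_int x) (Suc k) - sym_binom (of_int x) k) \<in> \<int>"
proof -
  define y where "y = int_binom (x + int (Suc k)) (2 * Suc k) + int_binom (x + int k) (2 * Suc k)"
  define B where "B = int_binom (2 * int (Suc k) - 1) (Suc k)"
  have "y = of_int x / of_nat (Suc k) * (of_int x + of_nat k gchoose (2 * k + 1))"
    unfolding gbinomial_even_sum by (simp add: y_def int_binom_def algebra_simps)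
  moreover have "B = (of_nat (2 * k + 1) gchoose Suc k)"
    by (simp add: int_binom_def B_def algebra_simps)
  ultimately have "c * (sym_binom (of_int x) (Suc k) - sym_binom (of_int x) k)
      = - ((- 1) ^ k * y * (B * c))"
    unfolding sym_binom_diff by (simp del: of_nat_Suc)
  also have "\<dots> \<in> \<int>"
    using assms by (auto simp: B_def y_def intro!: Ints_mult Ints_add int_binom_in_Ints Ints_power)
  finally show ?thesis .
qed

lemma mult_sym_binom_diff_in_int_multiples:
  assumes "int_binom (2 * int (Suc k) - 1) (Suc k) * c \<in> int_multiples (Suc k)"
    and "x = int b * int d"
  shows "c * (sym_binom (of_int x) (Suc k) - sym_binom (of_int x) k) \<in> int_multiples d"
proof -
  define B where "B = int_binom (2 * int (Suc k) - 1) (Suc k)"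
  obtain z where z: "z \<in> \<int>" "B * c = of_nat (Suc k) * z"
    using assms(1) unfolding B_def by (rule int_multiplesE)
  define y where "y = int_binom (x + int k) (2 * k + 1)"
  have B: "B = (of_nat (2 * k + 1) gchoose Suc k)"
    by (simp add: int_binom_def B_def algebra_simps)
  have "c * (sym_binom (of_int x) (Suc k) - sym_binom (of_int x) k)
      = - ((- 1) ^ k * of_int x * y * (B * c) / of_nat (Suc k))"
    unfolding sym_binom_diff B y_def int_binom_def by (simp del: of_nat_Suc)
  \<comment> \<open>The factor \<open>Suc k\<close> of \<open>B * c\<close> cancels the denominator,
    and \<open>x = b * d\<close> supplies \<open>d\<close>.\<close>
  also have "\<dots> = of_nat d * ((- 1) ^ Suc k * of_nat b * y * z)"
    unfolding z(2) by (simp add: assms(2) del: of_nat_Suc)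
  also have "\<dots> \<in> int_multiples d"
    unfolding y_def
    by (intro int_multiplesI Ints_mult Ints_power Ints_minus Ints_1 Ints_of_nat int_binom_in_Ints z(1))
  finally show ?thesis .
qed

theorem theorem4p3:
  fixes m n :: nat and a :: "nat \<Rightarrow> nat" and f :: "nat \<Rightarrow> rat"
  assumes "m \<ge> 1"
    and "\<forall>i\<in>{1..m}. a i > 0"
    and "Min (a ` {1..m}) = 1"
    and "n > 0"
  shows "((\<forall>k. int_binom (2 * int k - 1) k * f k \<in> \<int>) \<longrightarrow>
            (\<Sum>k = 0..<n. fwd_diff f k *
               (\<Prod>i = 1..m. int_binom (int (a i) * int n - 1) k *
                             int_binom (- int (a i) * int n - 1) k)) \<in> \<int>)
       \<and> ((\<forall>k. int_binom (2 * int k - 1) k * f k \<in> int_multiples k) \<longrightarrow>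
            1 / of_nat n * (\<Sum>k = 0..<n. fwd_diff f k *
               (\<Prod>i = 1..m. int_binom (int (a i) * int n - 1) k *
                             int_binom (- int (a i) * int n - 1) k)) \<in> \<int>)"
proof -
  define x where "x i = int (a i) * int n" for i
  define P where "P k = (\<Prod>i = 1..m. sym_binom (of_int (x i)) k)" for k
  have P_eq: "(\<Prod>i = 1..m. int_binom (int (a i) * int n - 1) k *
      int_binom (- int (a i) * int n - 1) k) = P k" for k
    by (simp add: P_def x_def sym_binom_of_int del: of_int_mult)
  have "a ` {1..m} \<noteq> {}" using assms(1) by simp
  then have "1 \<in> a ` {1..m}"
    using Min_in[of "a ` {1..m}"] assms(3) by (metis finite_imageI finite_atLeastAtMost)
  then obtain i where i: "i \<in> {1..m}" "a i = 1" by auto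
  \<comment> \<open>Here \<open>x i = n\<close>, so the last factor of the recurrence is
    \<open>1 - n^2 / n^2\<close>.\<close>
  have "sym_binom (of_int (x i)) n = 0"
    using sym_binom_Suc[of "of_nat n" "n - 1"] i assms(4) by (simp add: x_def)
  then have Pn: "P n = 0"
    using i(1) unfolding P_def by (intro prod_zero) auto
  have P0: "P 0 = 1"
    by (simp add: P_def sym_binom_def)
  have p_int: "sym_binom (of_int (x i)) k \<in> \<int>" for i k
    by (simp add: sym_binom_of_int int_binom_in_Ints)
  \<comment> \<open>The condition on \<open>f 0\<close> handles the lower boundary term, where
    \<open>P 0 = 1\<close>.\<close>
  have key: "(\<Sum>k = 0..<n. fwd_diff f k * P k) \<in> int_multiples d"
    if "f 0 \<in> int_multiples d"
      and "\<And>k i. f (Suc k) * (sym_binom (of_int (x i)) (Suc k) - sym_binom (of_int (x i)) k)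
             \<in> int_multiples d" for d
  proof -
    have "f (Suc k) * (P (Suc k) - P k) \<in> int_multiples d" for k
      unfolding P_def
      by (rule prod_diff_in_int_multiples)
        (auto intro: that simp: p_int)
    then have "(\<Sum>k = 0..<n. f (Suc k) * (P (Suc k) - P k)) \<in> int_multiples d"
      by (intro int_multiples_sum) auto
    then have "- (f 0 + (\<Sum>k = 0..<n. f (Suc k) * (P (Suc k) - P k))) \<in> int_multiples d"
      by (intro int_multiples_add int_multiples_minus that(1))
    then show ?thesis
      unfolding sum_fwd_diff_mult[of P, OF Pn] by (simp add: P0)
  qed
  show ?thesis
    unfolding P_eq
  proof (intro conjI impI)
    assume f: "\<forall>k. int_binom (2 * int k - 1) k * f k \<in> \<int>"
    have "f 0 \<in> \<int>" using f[rule_format, of 0] by (simp add: int_binom_def)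
    then show "(\<Sum>k = 0..<n. fwd_diff f k * P k) \<in> \<int>"
      using key[of 1] mult_sym_binom_diff_in_Ints f unfolding int_multiples_1 by blast
  next
    assume f: "\<forall>k. int_binom (2 * int k - 1) k * f k \<in> int_multiples k"
    \<comment> \<open>At \<open>k = 0\<close> the binomial is 1 and \<open>int_multiples 0\<close>
      is \<open>{0}\<close>, so \<open>f 0 = 0\<close>.\<close>
    have "f 0 \<in> int_multiples n"
      using f[rule_format, of 0] by (auto simp: int_binom_def int_multiples_def)
    then have "(\<Sum>k = 0..<n. fwd_diff f k * P k) \<in> int_multiples n"
      using key[of n] mult_sym_binom_diff_in_int_multiples[OF f[rule_format] x_def] by blast
    then show "1 / of_nat n * (\<Sum>k = 0..<n. fwd_diff f k * P k) \<in> \<int>"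
      using assms(4) by (auto elim!: int_multiplesE)
  qed
qed

end
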